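(* Let $\le_r$ be any reducibility on $2^\omega$ lying between one-one reducibility and Turing reducibility (i.e. $X\le_1 Y\Rightarrow X\le_r Y\Rightarrow X\le_T Y$), and let $\mathcal D_r$ be its degree structure. If a permutation $\theta:\omega\to\omega$ induces an automorphism $\pi$ of $\mathcal D_r$ (meaning $\pi([A]_r)=[A\circ\theta]_r$ for all $A\in 2^\omega$ is well defined and is an automorphism), then $\pi$ is trivial, i.e. $\pi$ is the identity.
   Context: Sets $A\subseteq\omega$ are identified with their characteristic functions in $2^\omega$. $\le_1$ is one-one reducibility, $\le_T$ Turing reducibility; $\le_r$ is a preorder, $X\equiv_r Y$ iff $X\le_r Y\le_r X$, $\mathcal D_r=2^\omega/\!\equiv_r$ ordered by $\le_r$, and $[A]_r$ denotes the degree of $A$. An automorphism of $\mathcal D_r$ is an order-preserving and order-reflecting bijection of $\mathcal D_r$; it is nontrivial if it moves some degree. *)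

theory Defs
  imports Main
begin

text \<open>
  Elements of \<open>2\<^sup>\<omega>\<close> are taken literally as characteristic functions, of type \<open>nat \<Rightarrow> bool\<close>, so that
  \<open>A \<circ> \<theta>\<close> is ordinary composition. Relative computability is defined by Kleene's scheme:
  the functions partial recursive in \<open>B\<close> are generated from zero, successor, projections
  and the characteristic function of \<open>B\<close> by composition, primitive recursion and minimization.
\<close>

type_synonym cantor = "nat \<Rightarrow> bool"

datatype prog =
    Zero
  | Succ
  | Proj nat
  | Oracle
  | Comp prog "prog list"
  | PrimRec prog prog
  | Minim prog

text \<open>
  \<open>computes B p xs y\<close>: on the argument tuple \<open>xs\<close> and with oracle \<open>B\<close>, the program \<open>p\<close> halts
  with output \<open>y\<close>. Programs carry no arity; a program applied to a tuple of unsuitable length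
  has no output. In the rule for \<open>Minim\<close> the values below the least zero must all be defined.
\<close>

inductive computes :: "cantor \<Rightarrow> prog \<Rightarrow> nat list \<Rightarrow> nat \<Rightarrow> bool" for B :: cantor where
  zero: "computes B Zero xs 0"
| succ: "computes B Succ [x] (Suc x)"
| proj: "i < length xs \<Longrightarrow> computes B (Proj i) xs (xs ! i)"
| query: "computes B Oracle [x] (of_bool (B x))"
| comp: "list_all2 (\<lambda>g z. computes B g xs z) gs zs \<Longrightarrow> computes B f zs y \<Longrightarrow>
    computes B (Comp f gs) xs y"
| primrec_0: "computes B f xs y \<Longrightarrow> computes B (PrimRec f g) (0 # xs) y"
| primrec_Suc: "computes B (PrimRec f g) (n # xs) v \<Longrightarrow> computes B g (n # v # xs) y \<Longrightarrow>
    computes B (PrimRec f g) (Suc n # xs) y"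
| minim: "computes B f (y # xs) 0 \<Longrightarrow> \<forall>z<y. \<exists>v>0. computes B f (z # xs) v \<Longrightarrow>
    computes B (Minim f) xs y"

definition computable_in :: "cantor \<Rightarrow> (nat \<Rightarrow> nat) \<Rightarrow> bool" where
  "computable_in B f \<longleftrightarrow> (\<exists>p. \<forall>n. computes B p [n] (f n))"

text \<open>Computability without oracle is computability relative to the empty set.\<close>

definition computable :: "(nat \<Rightarrow> nat) \<Rightarrow> bool" where
  "computable f \<longleftrightarrow> computable_in (\<lambda>_. False) f"

definition turing_reducible :: "cantor \<Rightarrow> cantor \<Rightarrow> bool"  (infix "\<le>\<^sub>T" 50) where
  "A \<le>\<^sub>T B \<longleftrightarrow> computable_in B (\<lambda>n. of_bool (A n))"

definition one_one_reducible :: "cantor \<Rightarrow> cantor \<Rightarrow> bool"  (infix "\<le>\<^sub>1" 50) where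
  "A \<le>\<^sub>1 B \<longleftrightarrow> (\<exists>f. computable f \<and> inj f \<and> (\<forall>n. A n \<longleftrightarrow> B (f n)))"

definition reducibility_equiv :: "(cantor \<Rightarrow> cantor \<Rightarrow> bool) \<Rightarrow> (cantor \<times> cantor) set" where
  "reducibility_equiv r = {(X, Y). r X Y \<and> r Y X}"

definition degree_of :: "(cantor \<Rightarrow> cantor \<Rightarrow> bool) \<Rightarrow> cantor \<Rightarrow> cantor set" where
  "degree_of r A = reducibility_equiv r `` {A}"

definition degrees :: "(cantor \<Rightarrow> cantor \<Rightarrow> bool) \<Rightarrow> cantor set set" where
  "degrees r = UNIV // reducibility_equiv r"

text \<open>For a preorder \<open>r\<close>, whether \<open>r X Y\<close> holds does not depend on the choice of representatives.\<close>

definition degree_le :: "(cantor \<Rightarrow> cantor \<Rightarrow> bool) \<Rightarrow> cantor set \<Rightarrow> cantor set \<Rightarrow> bool" where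
  "degree_le r a b \<longleftrightarrow> (\<exists>X\<in>a. \<exists>Y\<in>b. r X Y)"

definition degree_automorphism ::
    "(cantor \<Rightarrow> cantor \<Rightarrow> bool) \<Rightarrow> (cantor set \<Rightarrow> cantor set) \<Rightarrow> bool" where
  "degree_automorphism r \<pi> \<longleftrightarrow> bij_betw \<pi> (degrees r) (degrees r) \<and>
     (\<forall>a\<in>degrees r. \<forall>b\<in>degrees r. degree_le r a b \<longleftrightarrow> degree_le r (\<pi> a) (\<pi> b))"

text \<open>
  Since \<open>\<pi>\<close> is a function on degrees, the second conjunct includes that
  \<open>[A]\<^sub>r \<mapsto> [A \<circ> \<theta>]\<^sub>r\<close> is well defined.
\<close>

definition induces_automorphism ::
    "(cantor \<Rightarrow> cantor \<Rightarrow> bool) \<Rightarrow> (nat \<Rightarrow> nat) \<Rightarrow> (cantor set \<Rightarrow> cantor set) \<Rightarrow> bool" where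
  "induces_automorphism r \<theta> \<pi> \<longleftrightarrow>
     degree_automorphism r \<pi> \<and> (\<forall>A. \<pi> (degree_of r A) = degree_of r (A \<circ> \<theta>))"

end

theory Submission
  imports Defs "HOL-Library.Countable" Complex_Main
begin

text \<open>
  Put \<open>g = \<theta>\<^sup>-\<^sup>1 \<circ> Suc \<circ> \<theta>\<close>. Since \<open>Y \<circ> Suc \<le>\<^sub>1 Y\<close> for all \<open>Y\<close>, applying the automorphism to
  \<open>Y = B \<circ> \<theta>\<^sup>-\<^sup>1\<close> gives \<open>B \<circ> g \<le>\<^sub>T B\<close> for every \<open>B\<close>. A Baire category argument makes these
  reductions uniform above some finite string, and then \<open>g\<close> is computable. As
  \<open>\<theta>\<^sup>-\<^sup>1 k = g\<^sup>k (\<theta>\<^sup>-\<^sup>1 0)\<close>, both \<open>\<theta>\<^sup>-\<^sup>1\<close> and \<open>\<theta>\<close> are computable, so \<open>A \<circ> \<theta>\<close> and \<open>A\<close> are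
  even one-one equivalent.
\<close>

section \<open>Total recursive functions of fixed arity\<close>

text \<open>Recursion and search need auxiliary arguments, so oracle-free computability is extended
  from single numbers to tuples. Programs carry no arity, hence the explicit length
  \<open>k\<close>.\<close>

definition recursive :: "nat \<Rightarrow> (nat list \<Rightarrow> nat) \<Rightarrow> bool" where
  "recursive k F \<longleftrightarrow> (\<exists>p. \<forall>xs. length xs = k \<longrightarrow> computes (\<lambda>_. False) p xs (F xs))"

lemma recursive_cong:
  assumes "recursive k F" and "\<And>xs. length xs = k \<Longrightarrow> F xs = G xs"
  shows "recursive k G"
  using assms unfolding recursive_def by metis

lemma computable_iff_recursive: "computable f \<longleftrightarrow> recursive 1 (\<lambda>xs. f (xs ! 0))"
proof -
  have "(\<forall>n. computes B p [n] (f n)) \<longleftrightarrow> (\<forall>xs. length xs = 1 \<longrightarrow> computes B p xs (f (xs ! 0)))" for B p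
    by (auto simp: length_Suc_conv)
  then show ?thesis
    by (simp add: computable_def computable_in_def recursive_def)
qed

lemma recursive_nth: "i < k \<Longrightarrow> recursive k (\<lambda>xs. xs ! i)"
  unfolding recursive_def using computes.proj by blast

lemma recursive_comp:
  assumes F: "recursive (length Gs) F" and Gs: "\<forall>G\<in>set Gs. recursive k G"
  shows "recursive k (\<lambda>xs. F (map (\<lambda>G. G xs) Gs))"
proof -
  obtain f where f: "\<And>xs. length xs = length Gs \<Longrightarrow> computes (\<lambda>_. False) f xs (F xs)"
    using F unfolding recursive_def by blast
  obtain P where P: "\<And>G xs. G \<in> set Gs \<Longrightarrow> length xs = k \<Longrightarrow> computes (\<lambda>_. False) (P G) xs (G xs)"
    using Gs unfolding recursive_def by metis
  have "computes (\<lambda>_. False) (Comp f (map P Gs)) xs (F (map (\<lambda>G. G xs) Gs))" if "length xs = k" for xs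
    using that by (intro computes.comp[where zs = "map (\<lambda>G. G xs) Gs"] f)
      (auto simp: list.rel_map list_all2_same P)
  then show ?thesis
    unfolding recursive_def by blast
qed

lemma recursive_comp1:
  assumes "recursive 1 (\<lambda>ys. f (ys ! 0))" and "recursive k F"
  shows "recursive k (\<lambda>xs. f (F xs))"
  using recursive_comp[of "[F]" "\<lambda>ys. f (ys ! 0)" k] assms by simp

lemma recursive_Suc:
  assumes "recursive k F"
  shows "recursive k (\<lambda>xs. Suc (F xs))"
proof (rule recursive_comp1[OF _ assms])
  show "recursive 1 (\<lambda>ys. Suc (ys ! 0))"
    unfolding recursive_def by (rule exI[of _ Succ]) (auto simp: length_Suc_conv computes.succ)
qed

lemma recursive_const: "recursive k (\<lambda>xs. c)"
proof (induction c)
  case 0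
  show ?case
    unfolding recursive_def using computes.zero by blast
qed (rule recursive_Suc)

text \<open>Recursion and search put auxiliary arguments in front of the tuple; a function of the
  old parameters stays usable behind them.\<close>

lemma recursive_drop:
  assumes "recursive j F"
  shows "recursive (k + j) (\<lambda>ys. F (drop k ys))"
proof (rule recursive_cong)
  let ?Gs = "map (\<lambda>i ys. ys ! (k + i)) [0..<j]"
  show "recursive (k + j) (\<lambda>xs. F (map (\<lambda>G. G xs) ?Gs))"
    by (rule recursive_comp) (auto simp: assms intro: recursive_nth)
  show "F (map (\<lambda>G. G xs) ?Gs) = F (drop k xs)" if "length xs = k + j" for xs
    using that by (intro arg_cong[of _ _ F] nth_equalityI) auto
qed

text \<open>\<open>G\<close> reads counter, previous value and parameters in the argument order of
  \<open>PrimRec\<close>.\<close>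

lemma recursive_rec_hd:
  assumes F: "recursive k F" and G: "recursive (Suc (Suc k)) G"
  shows "recursive (Suc k) (\<lambda>ys. rec_nat (F (tl ys)) (\<lambda>i v. G (i # v # tl ys)) (hd ys))"
proof -
  obtain f g where f: "\<And>xs. length xs = k \<Longrightarrow> computes (\<lambda>_. False) f xs (F xs)"
    and g: "\<And>xs. length xs = Suc (Suc k) \<Longrightarrow> computes (\<lambda>_. False) g xs (G xs)"
    using F G unfolding recursive_def by blast
  have "computes (\<lambda>_. False) (PrimRec f g) (n # xs) (rec_nat (F xs) (\<lambda>i v. G (i # v # xs)) n)"
    if "length xs = k" for n xs
    by (induction n) (auto intro!: computes.primrec_0 f computes.primrec_Suc g simp: that)
  then show ?thesis
    unfolding recursive_def by (intro exI[of _ "PrimRec f g"]) (auto simp: length_Suc_conv)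
qed

lemma recursive_Cons:
  assumes "recursive (Suc k) F" and "recursive k H"
  shows "recursive k (\<lambda>xs. F (H xs # xs))"
proof (rule recursive_cong)
  let ?Gs = "H # map (\<lambda>i xs. xs ! i) [0..<k]"
  show "recursive k (\<lambda>xs. F (map (\<lambda>G. G xs) ?Gs))"
    by (rule recursive_comp) (auto simp: assms intro: recursive_nth)
  show "F (map (\<lambda>G. G xs) ?Gs) = F (H xs # xs)" if "length xs = k" for xs
    using that by (intro arg_cong[of _ _ F] nth_equalityI) (auto simp: nth_Cons split: nat.split)
qed

lemma recursive_rec:
  assumes "recursive k H" and "recursive k F" and "recursive (Suc (Suc k)) G"
  shows "recursive k (\<lambda>xs. rec_nat (F xs) (\<lambda>i v. G (i # v # xs)) (H xs))"
  using recursive_Cons[OF recursive_rec_hd[OF assms(2,3)] assms(1)] by simp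

text \<open>The existence assumption makes the unbounded search total; \<open>F\<close> is total, so
  the values below the least zero are defined, as \<open>Minim\<close> demands.\<close>

lemma recursive_Least:
  assumes F: "recursive (Suc k) F" and ex: "\<And>xs. length xs = k \<Longrightarrow> \<exists>y. F (y # xs) = 0"
  shows "recursive k (\<lambda>xs. LEAST y. F (y # xs) = 0)"
proof -
  obtain f where f: "\<And>xs. length xs = Suc k \<Longrightarrow> computes (\<lambda>_. False) f xs (F xs)"
    using F unfolding recursive_def by blast
  have "computes (\<lambda>_. False) (Minim f) xs (LEAST y. F (y # xs) = 0)" if len: "length xs = k" for xs
  proof (rule computes.minim)
    let ?y = "LEAST y. F (y # xs) = 0"
    have "F (?y # xs) = 0"
      using ex[OF len] by (rule LeastI_ex)
    then show "computes (\<lambda>_. False) f (?y # xs) 0"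
      using f[of "?y # xs"] len by simp
    show "\<forall>z<?y. \<exists>v>0. computes (\<lambda>_. False) f (z # xs) v"
    proof (intro allI impI)
      fix z assume "z < ?y"
      then have "F (z # xs) > 0"
        using not_less_Least by blast
      moreover have "computes (\<lambda>_. False) f (z # xs) (F (z # xs))"
        using len by (intro f) simp
      ultimately show "\<exists>v>0. computes (\<lambda>_. False) f (z # xs) v"
        by blast
    qed
  qed
  then show ?thesis
    unfolding recursive_def by blast
qed

section \<open>Arithmetic, bounded products and bounded quantifiers\<close>

lemma recursive_add:
  assumes "recursive k F" and "recursive k G"
  shows "recursive k (\<lambda>xs. F xs + G xs)"
proof (rule recursive_cong[OF recursive_rec[OF assms]])
  \<comment> \<open>In a recursion step, position 0 holds the counter, position 1 the value so far,
    and the parameters start at position 2.\<close>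
  show "recursive (Suc (Suc k)) (\<lambda>ys. Suc (ys ! 1))"
    by (intro recursive_Suc recursive_nth) simp
  have "rec_nat b (\<lambda>i v. Suc v) a = a + b" for a b :: nat
    by (induction a) auto
  then show "rec_nat (G xs) (\<lambda>i v. Suc ((i # v # xs) ! 1)) (F xs) = F xs + G xs" for xs
    by simp
qed

lemma recursive_mult:
  assumes "recursive k F" and "recursive k G"
  shows "recursive k (\<lambda>xs. F xs * G xs)"
proof (rule recursive_cong[OF recursive_rec[OF assms(1) recursive_const[of k 0]]])
  show "recursive (Suc (Suc k)) (\<lambda>ys. ys ! 1 + G (drop 2 ys))"
    using recursive_drop[OF assms(2), of 2] by (intro recursive_add recursive_nth) simp_all
  have "rec_nat 0 (\<lambda>i v. v + b) a = a * b" for a b :: nat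
    by (induction a) auto
  then show "rec_nat 0 (\<lambda>i v. (i # v # xs) ! 1 + G (drop 2 (i # v # xs))) (F xs) = F xs * G xs" for xs
    by simp
qed

lemma recursive_diff:
  assumes "recursive k F" and "recursive k G"
  shows "recursive k (\<lambda>xs. F xs - G xs)"
proof -
  have pred: "recursive 1 (\<lambda>ys. ys ! 0 - 1)"
  proof (rule recursive_cong[OF recursive_rec[OF recursive_nth recursive_const[of 1 0]]])
    show "recursive (Suc (Suc 1)) (\<lambda>ys. ys ! 0)"
      by (rule recursive_nth) simp
    show "rec_nat 0 (\<lambda>i v. (i # v # xs) ! 0) (xs ! 0) = xs ! 0 - 1" for xs
      by (cases "xs ! 0") auto
  qed simp
  show ?thesis
  proof (rule recursive_cong[OF recursive_rec[OF assms(2,1)]])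
    show "recursive (Suc (Suc k)) (\<lambda>ys. ys ! 1 - 1)"
      by (rule recursive_comp1[OF pred recursive_nth]) simp
    have "rec_nat a (\<lambda>i v. v - 1) b = a - b" for a b :: nat
      by (induction b) auto
    then show "rec_nat (F xs) (\<lambda>i v. (i # v # xs) ! 1 - 1) (G xs) = F xs - G xs" for xs
      by simp
  qed
qed

lemma recursive_prod:
  assumes "recursive k H" and "recursive (Suc k) F"
  shows "recursive k (\<lambda>xs. \<Prod>i<H xs. F (i # xs))"
proof (rule recursive_cong[OF recursive_rec[OF assms(1) recursive_const[of k 1]]])
  \<comment> \<open>\<open>F\<close> takes the counter and the parameters but not the accumulated
    product, so position 1 is skipped.\<close>
  have "recursive (Suc (Suc k)) (\<lambda>ys. F (map (\<lambda>G. G ys) ((\<lambda>ys. ys ! 0) # map (\<lambda>i ys. ys ! (2 + i)) [0..<k])))"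
    by (rule recursive_comp) (auto simp: assms intro: recursive_nth)
  then have "recursive (Suc (Suc k)) (\<lambda>ys. F (hd ys # drop 2 ys))"
  proof (rule recursive_cong)
    show "F (map (\<lambda>G. G ys) ((\<lambda>ys. ys ! 0) # map (\<lambda>i ys. ys ! (2 + i)) [0..<k])) = F (hd ys # drop 2 ys)"
      if "length ys = Suc (Suc k)" for ys
      using that by (intro arg_cong[of _ _ F] nth_equalityI)
        (auto simp: nth_Cons length_Suc_conv split: nat.split)
  qed
  then show "recursive (Suc (Suc k)) (\<lambda>ys. ys ! 1 * F (hd ys # drop 2 ys))"
    by (intro recursive_mult recursive_nth) simp
  have "rec_nat 1 (\<lambda>i v. v * F (i # xs)) n = (\<Prod>i<n. F (i # xs))" for n xs
    by (induction n) auto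
  then show "rec_nat 1 (\<lambda>i v. (i # v # xs) ! 1 * F (hd (i # v # xs) # drop 2 (i # v # xs))) (H xs) =
      (\<Prod>i<H xs. F (i # xs))" for xs
    by simp
qed

text \<open>With truth values \<open>0\<close> and \<open>1\<close>, bounded universal
  quantification is a product.\<close>

lemma recursive_all_less:
  assumes "recursive k H" and "recursive (Suc k) (\<lambda>ys. of_bool (P ys))"
  shows "recursive k (\<lambda>xs. of_bool (\<forall>i<H xs. P (i # xs)))"
proof (rule recursive_cong[OF recursive_prod[OF assms]])
  have "(\<Prod>i<n. of_bool (P (i # xs)) :: nat) = of_bool (\<forall>i<n. P (i # xs))" for n xs
    by (induction n) (auto simp: less_Suc_eq)
  then show "(\<Prod>i<H xs. of_bool (P (i # xs))) = (of_bool (\<forall>i<H xs. P (i # xs)) :: nat)" for xs .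
qed

section \<open>Decidable relations, case distinction and binary digits\<close>

lemma recursive_not:
  assumes "recursive k (\<lambda>xs. of_bool (P xs))"
  shows "recursive k (\<lambda>xs. of_bool (\<not> P xs))"
  using recursive_diff[OF recursive_const[of k 1] assms] by (rule recursive_cong) simp

lemma recursive_conj:
  assumes "recursive k (\<lambda>xs. of_bool (P xs))" and "recursive k (\<lambda>xs. of_bool (Q xs))"
  shows "recursive k (\<lambda>xs. of_bool (P xs \<and> Q xs))"
  using recursive_mult[OF assms] by (rule recursive_cong) simp

text \<open>Subtraction truncates at \<open>0\<close>, so \<open>F xs - G xs\<close> vanishes
  exactly when the inequality holds.\<close>

lemma recursive_le:
  assumes "recursive k F" and "recursive k G"
  shows "recursive k (\<lambda>xs. of_bool (F xs \<le> G xs))"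
  using recursive_diff[OF recursive_const[of k 1] recursive_diff[OF assms]]
  by (rule recursive_cong) auto

lemma recursive_eq:
  assumes "recursive k F" and "recursive k G"
  shows "recursive k (\<lambda>xs. of_bool (F xs = G xs))"
  using recursive_conj[OF recursive_le[OF assms] recursive_le[OF assms(2,1)]]
  by (rule recursive_cong) auto

lemma recursive_if:
  assumes "recursive k (\<lambda>xs. of_bool (P xs))" and "recursive k F" and "recursive k G"
  shows "recursive k (\<lambda>xs. if P xs then F xs else G xs)"
  using recursive_add[OF recursive_mult[OF assms(1,2)]
    recursive_mult[OF recursive_not[OF assms(1)] assms(3)]]
  by (rule recursive_cong) auto

lemma recursive_div2:
  assumes "recursive k F"
  shows "recursive k (\<lambda>xs. F xs div 2)"
proof (rule recursive_comp1[OF _ assms])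
  have odd: "recursive 1 (\<lambda>ys. of_bool (odd (ys ! 0)))"
  proof (rule recursive_cong[OF recursive_rec[OF recursive_nth recursive_const[of 1 0]]])
    show "recursive (Suc (Suc 1)) (\<lambda>ys. 1 - ys ! 1)"
      by (intro recursive_diff recursive_const recursive_nth) simp
    have "rec_nat 0 (\<lambda>i v. 1 - v) n = (of_bool (odd n) :: nat)" for n
      by (induction n) auto
    then show "rec_nat 0 (\<lambda>i v. 1 - (i # v # xs) ! 1) (xs ! 0) = of_bool (odd (xs ! 0))" for xs
      by simp
  qed simp
  show "recursive 1 (\<lambda>ys. ys ! 0 div 2)"
  proof (rule recursive_cong[OF recursive_rec[OF recursive_nth recursive_const[of 1 0]]])
    show "recursive (Suc (Suc 1)) (\<lambda>ys. ys ! 1 + of_bool (odd (ys ! 0)))"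
      by (intro recursive_add recursive_nth recursive_comp1[OF odd]) simp_all
    \<comment> \<open>Passing from \<open>i\<close> to \<open>Suc i\<close> raises the half by one
      exactly when \<open>i\<close> is odd.\<close>
    have "rec_nat 0 (\<lambda>i v. v + of_bool (odd i)) n = n div 2" for n
      by (induction n) auto
    then show "rec_nat 0 (\<lambda>i v. (i # v # xs) ! 1 + of_bool (odd ((i # v # xs) ! 0))) (xs ! 0)
        = xs ! 0 div 2" for xs
      by simp
  qed simp
qed

text \<open>Iterated halving moves the wanted digit to the last place, where parity reads it. Binary
  digits will serve as finite oracles.\<close>

lemma recursive_bit:
  assumes "recursive k F" and "recursive k G"
  shows "recursive k (\<lambda>xs. of_bool (bit (F xs) (G xs)))"
proof -
  have "recursive k (\<lambda>xs. F xs div 2 ^ G xs)"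
  proof (rule recursive_cong[OF recursive_rec[OF assms(2,1)]])
    show "recursive (Suc (Suc k)) (\<lambda>ys. ys ! 1 div 2)"
      by (intro recursive_div2 recursive_nth) simp
    have "rec_nat a (\<lambda>i v. v div 2) n = a div 2 ^ n" for a n :: nat
      by (induction n) (auto simp: div_mult2_eq[symmetric] mult.commute)
    then show "rec_nat (F xs) (\<lambda>i v. (i # v # xs) ! 1 div 2) (G xs) = F xs div 2 ^ G xs" for xs
      by simp
  qed
  then have "recursive k (\<lambda>xs. of_bool (F xs div 2 ^ G xs \<noteq> 2 * (F xs div 2 ^ G xs div 2)))"
    by (intro recursive_not recursive_eq recursive_mult recursive_const recursive_div2)
  moreover have "n \<noteq> 2 * (n div 2) \<longleftrightarrow> odd n" for n :: nat
    by presburger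
  ultimately show ?thesis
    by (simp only: bit_iff_odd)
qed

text \<open>The search for \<open>g\<close> will be correct only from some argument on; the finitely
  many other values are hard-coded one at a time.\<close>

lemma recursive_finite_patch:
  assumes "recursive 1 (\<lambda>xs. h (xs ! 0))" and "\<And>n. N \<le> n \<Longrightarrow> h n = g n"
  shows "recursive 1 (\<lambda>xs. g (xs ! 0))"
  using assms
proof (induction N arbitrary: h)
  case 0
  then show ?case by simp
next
  case (Suc N)
  show ?case
  proof (rule Suc.IH)
    show "recursive 1 (\<lambda>xs. if xs ! 0 = N then g N else h (xs ! 0))"
      by (intro recursive_if recursive_eq recursive_nth recursive_const Suc.prems) simp
    show "(if n = N then g N else h n) = g n" if "N \<le> n" for n
      using that Suc.prems(2)[of n] by (cases "n = N") auto
  qed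
qed

section \<open>Evaluation with bounded minimization\<close>

text \<open>The value \<open>0\<close> stands for an undefined result and \<open>Suc y\<close> for the result \<open>y\<close>; the bound
  \<open>s\<close> limits only the search in \<open>Minim\<close>.\<close>

fun eval_bounded :: "nat \<Rightarrow> cantor \<Rightarrow> prog \<Rightarrow> nat list \<Rightarrow> nat" where
  "eval_bounded s B Zero xs = 1"
| "eval_bounded s B Succ xs = (if length xs = 1 then Suc (Suc (xs ! 0)) else 0)"
| "eval_bounded s B (Proj i) xs = (if i < length xs then Suc (xs ! i) else 0)"
| "eval_bounded s B Oracle xs = (if length xs = 1 then Suc (of_bool (B (xs ! 0))) else 0)"
| "eval_bounded s B (Comp f gs) xs =
    (if \<exists>g\<in>set gs. eval_bounded s B g xs = 0 then 0
     else eval_bounded s B f (map (\<lambda>g. eval_bounded s B g xs - 1) gs))"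
| "eval_bounded s B (PrimRec f g) [] = 0"
| "eval_bounded s B (PrimRec f g) (n # xs) =
    rec_nat (eval_bounded s B f xs)
      (\<lambda>i v. if v = 0 then 0 else eval_bounded s B g (i # (v - 1) # xs)) n"
| "eval_bounded s B (Minim f) xs =
    (let y = LEAST y. (s - y) * (eval_bounded s B f (y # xs) - 1) = 0
     in if eval_bounded s B f (y # xs) = 1 then Suc y else 0)"

text \<open>A bound that is too small can lose a result but never yields a wrong one, so every
  \<open>s\<close> is allowed.\<close>

lemma eval_bounded_sound: "eval_bounded s B p xs = Suc y \<Longrightarrow> computes B p xs y"
proof (induction p arbitrary: xs y)
  case (Comp f gs)
  let ?zs = "map (\<lambda>g. eval_bounded s B g xs - 1) gs"
  have ne: "eval_bounded s B g xs \<noteq> 0" if "g \<in> set gs" for g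
    using Comp.prems that by (auto split: if_splits)
  have "list_all2 (\<lambda>g z. computes B g xs z) gs ?zs"
    using Comp.IH(2) ne by (auto simp: list_all2_map2 list_all2_same)
  moreover have "computes B f ?zs y"
    using Comp.prems by (intro Comp.IH(1)) (auto split: if_splits)
  ultimately show ?case
    by (rule computes.comp)
next
  case (PrimRec f g)
  obtain n ys where xs: "xs = n # ys"
    using PrimRec.prems by (cases xs) auto
  have "computes B (PrimRec f g) (n # ys) y"
    if "eval_bounded s B (PrimRec f g) (n # ys) = Suc y" for y
    using that
  proof (induction n arbitrary: y)
    case 0
    then show ?case by (auto intro: computes.primrec_0 PrimRec.IH(1))
  next
    case (Suc n)
    let ?v = "eval_bounded s B (PrimRec f g) (n # ys)"
    have "?v = Suc (?v - 1)" and "eval_bounded s B g (n # (?v - 1) # ys) = Suc y"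
      using Suc.prems by (auto split: if_splits)
    then show ?case
      using Suc.IH PrimRec.IH(2) computes.primrec_Suc by metis
  qed
  then show ?case
    using PrimRec.prems xs by simp
next
  case (Minim f)
  \<comment> \<open>The search stops when the bound is reached or the coded value is
    \<open>0\<close> (undefined) or \<open>1\<close> (result zero). Before that, all values are at
    least \<open>2\<close>, hence defined and positive.\<close>
  let ?P = "\<lambda>y. (s - y) * (eval_bounded s B f (y # xs) - 1) = 0"
  have y: "y = (LEAST y. ?P y)" and 1: "eval_bounded s B f (y # xs) = 1"
    using Minim.prems by (auto simp: Let_def split: if_splits)
  have "\<exists>v>0. computes B f (z # xs) v" if "z < y" for z
  proof -
    have "\<not> ?P z"
      using that not_less_Least[of z ?P] y by blast
    then have "eval_bounded s B f (z # xs) = Suc (eval_bounded s B f (z # xs) - 1)"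
      and "eval_bounded s B f (z # xs) - 1 > 0"
      by auto
    then show ?thesis
      using Minim.IH by blast
  qed
  then show ?case
    using 1 by (intro computes.minim Minim.IH) auto
qed (auto split: if_splits simp: length_Suc_conv intro: computes.intros)

section \<open>Completeness of the evaluation, and the use of an oracle\<close>

lemma eventually_list_all2:
  "list_all2 (\<lambda>x y. \<forall>\<^sub>F s in F. P s x y) xs ys \<Longrightarrow> \<forall>\<^sub>F s in F. list_all2 (P s) xs ys"
proof (induction rule: list_all2_induct)
  case (Cons x xs y ys)
  then show ?case
    using eventually_conj[OF Cons(1,3)] by simp
qed simp

lemma eventually_all_less:
  "(\<And>z. z < y \<Longrightarrow> \<forall>\<^sub>F s in F. P s z) \<Longrightarrow> \<forall>\<^sub>F s in F. \<forall>z<(y::nat). P s z"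
  using eventually_ball_finite[of "{..<y}" "\<lambda>s z. P s z" F]
  by (auto elim!: eventually_mono)

text \<open>Because the claim is made for all large \<open>s\<close>, the bounds of finitely many
  subcomputations merge by filter reasoning.\<close>

lemma eval_bounded_complete:
  "computes B p xs y \<Longrightarrow> \<forall>\<^sub>F s in sequentially. eval_bounded s B p xs = Suc y"
proof (induction rule: computes.induct)
  case (comp xs gs zs f y)
  have "\<forall>\<^sub>F s in sequentially. list_all2 (\<lambda>g z. eval_bounded s B g xs = Suc z) gs zs"
    using comp.IH(1) by (intro eventually_list_all2) (auto elim: list_all2_mono)
  then show ?case
    using comp.IH(2)
  proof eventually_elim
    case (elim s)
    have "map (\<lambda>g. eval_bounded s B g xs - 1) gs = zs"
      using elim(1) by (auto simp: list_all2_conv_all_nth intro: nth_equalityI)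
    moreover have "\<forall>g\<in>set gs. eval_bounded s B g xs \<noteq> 0"
      using elim(1) by (auto simp: list_all2_conv_all_nth in_set_conv_nth)
    ultimately show ?case
      using elim(2) by auto
  qed
next
  case (primrec_Suc f g n xs v y)
  from primrec_Suc.IH show ?case
    by eventually_elim simp
next
  case (minim f y xs)
  have "\<forall>\<^sub>F s in sequentially. eval_bounded s B f (z # xs) > 1" if "z < y" for z
  proof -
    obtain v where "v > 0" and "\<forall>\<^sub>F s in sequentially. eval_bounded s B f (z # xs) = Suc v"
      using minim.IH(2)[THEN spec, THEN mp, OF \<open>z < y\<close>] by (elim exE conjE) auto
    from this(2) show ?thesis
      by eventually_elim (use \<open>v > 0\<close> in simp)
  qed
  then have "\<forall>\<^sub>F s in sequentially. \<forall>z<y. eval_bounded s B f (z # xs) > 1"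
    by (rule eventually_all_less)
  then show ?case
    using minim.IH(1) eventually_ge_at_top[of y]
  proof eventually_elim
    case (elim s)
    \<comment> \<open>As \<open>s\<close> is at least \<open>y\<close>, both factors are positive
      below \<open>y\<close>; at \<open>y\<close> the coded value \<open>1\<close> makes the second
      one vanish.\<close>
    have "(LEAST y. (s - y) * (eval_bounded s B f (y # xs) - 1) = 0) = y"
    proof (rule Least_equality)
      show "y \<le> z" if "(s - z) * (eval_bounded s B f (z # xs) - 1) = 0" for z
      proof (rule ccontr)
        assume "\<not> y \<le> z"
        then have "z < y" by simp
        then show False
          using that elim(1,3) by fastforce
      qed
    qed (simp add: elim(2))
    then show ?case
      using elim(2) by (simp add: Let_def)
  qed
qed simp_all

text \<open>The use principle: a halting computation asks only finitely many oracle
  questions.\<close>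

lemma computes_use:
  "computes B p xs y \<Longrightarrow>
    \<forall>\<^sub>F u in sequentially. \<forall>B'. (\<forall>x<u. B' x = B x) \<longrightarrow> computes B' p xs y"
proof (induction rule: computes.induct)
  case (query x)
  have "computes B' Oracle [x] (of_bool (B x))" if "Suc x \<le> u" "\<forall>x<u. B' x = B x" for u B'
    using that computes.query[of B' x] by simp
  then show ?case
    by (intro eventually_sequentiallyI[of "Suc x"]) blast
next
  case (comp xs gs zs f y)
  have "\<forall>\<^sub>F u in sequentially.
      list_all2 (\<lambda>g z. \<forall>B'. (\<forall>x<u. B' x = B x) \<longrightarrow> computes B' g xs z) gs zs"
    using comp.IH(1) by (intro eventually_list_all2) (auto elim: list_all2_mono)
  then show ?case
    using comp.IH(2)
  proof eventually_elim
    case (elim u)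
    show ?case
    proof (intro allI impI)
      fix B' assume "\<forall>x<u. B' x = B x"
      with elim show "computes B' (Comp f gs) xs y"
        by (intro computes.comp[where zs = zs]) (auto elim: list_all2_mono)
    qed
  qed
next
  case (primrec_0 f xs y g)
  from primrec_0.IH show ?case
    by eventually_elim (auto intro: computes.primrec_0)
next
  case (primrec_Suc f g n xs v y)
  from primrec_Suc.IH show ?case
    by eventually_elim (auto intro: computes.primrec_Suc)
next
  case (minim f y xs)
  have "\<forall>\<^sub>F u in sequentially. \<forall>B'. (\<forall>x<u. B' x = B x) \<longrightarrow> (\<exists>v>0. computes B' f (z # xs) v)"
    if "z < y" for z
  proof -
    obtain v where "v > 0"
      and "\<forall>\<^sub>F u in sequentially. \<forall>B'. (\<forall>x<u. B' x = B x) \<longrightarrow> computes B' f (z # xs) v"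
      using minim.IH(2)[THEN spec, THEN mp, OF \<open>z < y\<close>] by (elim exE conjE) auto
    from this(2) show ?thesis
      by eventually_elim (use \<open>v > 0\<close> in blast)
  qed
  then have "\<forall>\<^sub>F u in sequentially.
      \<forall>z<y. \<forall>B'. (\<forall>x<u. B' x = B x) \<longrightarrow> (\<exists>v>0. computes B' f (z # xs) v)"
    by (rule eventually_all_less)
  then show ?case
    using minim.IH(1) by eventually_elim (auto intro: computes.minim)
qed (auto intro!: always_eventually intro: computes.intros)

text \<open>Both results are the value of the same evaluation function at a large bound.\<close>

lemma computes_unique:
  assumes "computes B p xs y" and "computes B p xs z"
  shows "y = z"
proof -
  have "\<forall>\<^sub>F s in sequentially. Suc y = Suc z"
    using eval_bounded_complete[OF assms(1)] eval_bounded_complete[OF assms(2)]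
    by eventually_elim simp
  then show ?thesis
    by simp
qed

text \<open>Induction on the fixed program \<open>p\<close>, without numbering programs. The first
  \<open>k\<close> arguments are its input, the last \<open>j\<close> parametrize bound and oracle;
  \<open>k\<close> varies because subprograms take tuples of other lengths.\<close>

lemma recursive_eval_bounded:
  assumes S: "recursive j S" and D: "recursive (Suc j) (\<lambda>ys. of_bool (D (tl ys) (hd ys)))"
  shows "recursive (k + j) (\<lambda>ys. eval_bounded (S (drop k ys)) (D (drop k ys)) p (take k ys))"
proof (induction p arbitrary: k)
  case Zero
  show ?case
    by (simp add: recursive_const)
next
  case Succ
  show ?case
  proof (cases "k = 1")
    case True
    have "recursive (k + j) (\<lambda>ys. Suc (Suc (ys ! 0)))"
      using True by (intro recursive_Suc recursive_nth) simp
    then show ?thesis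
      by (rule recursive_cong) (simp add: True)
  next
    case False
    show ?thesis
      by (rule recursive_cong[OF recursive_const[of _ 0]]) (use False in simp)
  qed
next
  case (Proj i)
  show ?case
  proof (cases "i < k")
    case True
    have "recursive (k + j) (\<lambda>ys. Suc (ys ! i))"
      using True by (intro recursive_Suc recursive_nth) simp
    then show ?thesis
      by (rule recursive_cong) (simp add: True)
  next
    case False
    show ?thesis
      by (rule recursive_cong[OF recursive_const[of _ 0]]) (use False in simp)
  qed
next
  case Oracle
  show ?case
  proof (cases "k = 1")
    case True
    have "recursive (k + j) (\<lambda>ys. Suc (of_bool (D (tl ys) (hd ys))))"
      using True D by (intro recursive_Suc) simp
    then show ?thesis
      by (rule recursive_cong) (auto simp: True length_Suc_conv)
  next
    case False
    show ?thesis
      by (rule recursive_cong[OF recursive_const[of _ 0]]) (use False in simp)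
  qed
next
  case (Comp f gs)
  let ?ev = "\<lambda>p k ys. eval_bounded (S (drop k ys)) (D (drop k ys)) p (take k ys)"
  \<comment> \<open>The decoded results of \<open>gs\<close> become the input of \<open>f\<close>,
    and the parameters are copied behind them.\<close>
  let ?Gs = "map (\<lambda>g ys. ?ev g k ys - 1) gs @ map (\<lambda>i ys. ys ! (k + i)) [0..<j]"
  have any: "recursive (k + j) (\<lambda>ys. of_bool (\<exists>g\<in>set hs. ?ev g k ys = 0))"
    if "set hs \<subseteq> set gs" for hs
    using that
  proof (induction hs)
    case Nil
    show ?case
      by (rule recursive_cong[OF recursive_const[of _ 0]]) simp
  next
    case (Cons h hs)
    have "recursive (k + j) (\<lambda>ys. of_bool (\<not> (\<not> ?ev h k ys = 0 \<and> \<not> (\<exists>g\<in>set hs. ?ev g k ys = 0))))"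
      using Cons by (intro recursive_not recursive_conj recursive_eq recursive_const Comp.IH(2)) auto
    then show ?case
      by (rule recursive_cong) auto
  qed
  have "recursive (k + j) (\<lambda>ys. ?ev f (length gs) (map (\<lambda>G. G ys) ?Gs))"
    using Comp.IH
    by (intro recursive_comp) (auto intro!: recursive_diff recursive_const[of _ "Suc 0"] recursive_nth)
  then have "recursive (k + j) (\<lambda>ys. if \<exists>g\<in>set gs. ?ev g k ys = 0 then 0
      else ?ev f (length gs) (map (\<lambda>G. G ys) ?Gs))"
    using any by (intro recursive_if recursive_const) auto
  then show ?case
  proof (rule recursive_cong)
    fix ys :: "nat list" assume len: "length ys = k + j"
    have "map (\<lambda>i. ys ! (k + i)) [0..<j] = drop k ys"
      using len by (intro nth_equalityI) auto
    then have "map (\<lambda>G. G ys) ?Gs = map (\<lambda>g. ?ev g k ys - 1) gs @ drop k ys"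
      by (simp add: comp_def)
    moreover have "?ev f (length gs) (map (\<lambda>g. ?ev g k ys - 1) gs @ drop k ys) =
        eval_bounded (S (drop k ys)) (D (drop k ys)) f (map (\<lambda>g. ?ev g k ys - 1) gs)"
      by simp
    ultimately show "(if \<exists>g\<in>set gs. ?ev g k ys = 0 then 0
      else ?ev f (length gs) (map (\<lambda>G. G ys) ?Gs)) = ?ev (Comp f gs) k ys"
      by (simp only: eval_bounded.simps)
  qed
next
  case (PrimRec f g)
  let ?ev = "\<lambda>p k ys. eval_bounded (S (drop k ys)) (D (drop k ys)) p (take k ys)"
  show ?case
  proof (cases k)
    case 0
    show ?thesis
      by (rule recursive_cong[OF recursive_const[of _ 0]]) (simp add: 0)
  next
    case (Suc k')
    \<comment> \<open>The previous value arrives coded; \<open>- 1\<close> decodes it before it is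
      passed to \<open>g\<close>.\<close>
    let ?Gs = "(\<lambda>ys::nat list. ys ! 0) # (\<lambda>ys. ys ! 1 - 1) # map (\<lambda>i ys. ys ! (2 + i)) [0..<k' + j]"
    have "recursive (Suc (Suc (k' + j))) (\<lambda>ys. ?ev g (Suc (Suc k')) (map (\<lambda>G. G ys) ?Gs))"
      using PrimRec.IH(2)[of "Suc (Suc k')"]
      by (intro recursive_comp) (auto intro!: recursive_diff recursive_const[of _ "Suc 0"] recursive_nth)
    then have "recursive (Suc (Suc (k' + j)))
        (\<lambda>ys. if ys ! 1 = 0 then 0 else ?ev g (Suc (Suc k')) (map (\<lambda>G. G ys) ?Gs))"
      by (intro recursive_if recursive_eq recursive_const recursive_nth) simp_all
    from recursive_rec_hd[OF PrimRec.IH(1)[of k'] this]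
    have "recursive (k + j) (\<lambda>ys. rec_nat (?ev f k' (tl ys)) (\<lambda>i v. if (i # v # tl ys) ! 1 = 0 then 0
        else ?ev g (Suc (Suc k')) (map (\<lambda>G. G (i # v # tl ys)) ?Gs)) (hd ys))"
      by (simp only: Suc add_Suc)
    then show ?thesis
    proof (rule recursive_cong)
      fix ys :: "nat list" assume "length ys = k + j"
      then obtain n zs where ys: "ys = n # zs" and len: "length zs = k' + j"
        by (auto simp: Suc length_Suc_conv)
      have Gs: "map (\<lambda>G. G (i # v # zs)) ?Gs = i # (v - 1) # zs" for i v
        using len by (auto simp: comp_def intro!: nth_equalityI)
      show "rec_nat (?ev f k' (tl ys)) (\<lambda>i v. if (i # v # tl ys) ! 1 = 0 then 0
        else ?ev g (Suc (Suc k')) (map (\<lambda>G. G (i # v # tl ys)) ?Gs)) (hd ys) = ?ev (PrimRec f g) k ys"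
        unfolding ys list.sel Suc by (simp only: Gs) (simp cong: if_cong)
    qed
  qed
next
  case (Minim f)
  let ?ev = "\<lambda>p k ys. eval_bounded (S (drop k ys)) (D (drop k ys)) p (take k ys)"
  let ?F = "\<lambda>zs. (S (drop (Suc k) zs) - zs ! 0) * (?ev f (Suc k) zs - 1)"
  let ?y = "\<lambda>ys. LEAST y. ?F (y # ys) = 0"
  have f: "recursive (Suc (k + j)) (?ev f (Suc k))"
    using Minim.IH[of "Suc k"] by simp
  have "recursive (Suc (k + j)) ?F"
    using recursive_drop[OF S, of "Suc k"]
    by (intro recursive_mult recursive_diff recursive_const recursive_nth f) simp_all
  \<comment> \<open>The search is total: at \<open>y\<close> equal to the bound the first factor
    vanishes.\<close>
  then have y: "recursive (k + j) ?y"
    by (rule recursive_Least) (metis diff_self_eq_0 drop_Suc_Cons mult_0 nth_Cons_0)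
  then have "recursive (k + j) (\<lambda>ys. if ?ev f (Suc k) (?y ys # ys) = 1 then Suc (?y ys) else 0)"
    by (intro recursive_if recursive_eq recursive_const recursive_Suc y recursive_Cons[OF f])
  then show ?case
    by (rule recursive_cong) (simp add: Let_def)
qed

section \<open>Uniform reductions of \<open>B \<circ> g\<close> to \<open>B\<close>\<close>

instance prog :: countable
  by countable_datatype

text \<open>The pair \<open>C\<close>, \<open>l\<close> stands for the string of the first
  \<open>l\<close> values of \<open>C\<close>, above which \<open>S p\<close> is dense. If there
  were no such string, each string could be extended so as to avoid the next set \<open>S p\<close>,
  and the limit would lie in none of them.\<close>

lemma cantor_Baire:
  fixes S :: "'a::countable \<Rightarrow> cantor \<Rightarrow> bool"
  assumes "\<And>B. \<exists>p. S p B"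
  shows "\<exists>p C l. \<forall>A u. (\<forall>x<(l::nat). A x = C x) \<longrightarrow> (\<exists>B. (\<forall>x<u. B x = A x) \<and> S p B)"
proof (rule ccontr)
  define ext where "ext u A B \<longleftrightarrow> (\<forall>x<u. B x = A x)" for u :: nat and A B :: cantor
  assume "\<not> ?thesis"
  then have not_dense: "\<exists>A u. ext l C A \<and> (\<forall>B. ext u A B \<longrightarrow> \<not> S p B)" for p C l
    unfolding ext_def[symmetric] by blast
  define escapes where "escapes = (\<lambda>i (C, l) (A, u).
    (\<forall>x<l. A x = C x) \<and> (l::nat) < u \<and> (\<forall>B. (\<forall>x<u. B x = A x) \<longrightarrow> \<not> S (from_nat i) B))"
  have "\<exists>\<tau>. escapes i \<sigma> \<tau>" for i \<sigma>
  proof -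
    obtain C l where \<sigma>: "\<sigma> = (C, l)"
      by (cases \<sigma>)
    obtain A u where "\<forall>x<l. A x = C x" and "\<forall>B. (\<forall>x<u. B x = A x) \<longrightarrow> \<not> S (from_nat i) B"
      using not_dense[of l C "from_nat i"] unfolding ext_def by (elim exE conjE)
    \<comment> \<open>The maximum with \<open>Suc l\<close> makes the strings grow strictly, so that
      they determine a limit everywhere.\<close>
    then have "escapes i \<sigma> (A, max u (Suc l))"
      by (auto simp: escapes_def \<sigma>)
    then show ?thesis ..
  qed
  then have "\<exists>f. \<forall>i. True \<and> escapes i (f i) (f (Suc i))"
    by (intro dependent_nat_choice) auto
  then obtain f where f: "\<And>i. escapes i (f i) (f (Suc i))"
    by blast
  have agree: "fst (f (Suc i)) x = fst (f i) x" if "x < snd (f i)" for i x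
    using f[of i] that by (simp add: escapes_def split: prod.splits)
  have less: "snd (f i) < snd (f (Suc i))" for i
    using f[of i] by (simp add: escapes_def split: prod.splits)
  then have mono: "i \<le> j \<Longrightarrow> snd (f i) \<le> snd (f j)" for i j
    using lift_Suc_mono_le[of "\<lambda>i. snd (f i)"] less_imp_le by blast
  have stable: "fst (f (i + j)) x = fst (f i) x" if "x < snd (f i)" for i j x
  proof (induction j)
    case (Suc j)
    have "x < snd (f (i + j))"
      using that mono[of i "i + j"] by simp
    then show ?case
      using agree Suc by simp
  qed simp
  have ge: "i \<le> snd (f i)" for i
    by (induction i) (use less Suc_le_eq le_less_trans in blast)+
  \<comment> \<open>Stage \<open>x\<close> guarantees only length \<open>x\<close>; stage
    \<open>Suc x\<close> is the first sure to decide the value at \<open>x\<close>.\<close>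
  define B where "B x = fst (f (Suc x)) x" for x
  have B: "B x = fst (f i) x" if "x < snd (f i)" for i x
    using stable[of x i "Suc x"] stable[of x "Suc x" i] that ge[of "Suc x"]
    by (simp add: B_def add.commute)
  obtain p where "S p B"
    using assms by blast
  moreover have "\<not> S (from_nat (to_nat p)) B"
    using f[of "to_nat p"] B[of _ "Suc (to_nat p)"] by (simp add: escapes_def split: prod.splits)
  ultimately show False
    by simp
qed

lemma ex_nat_bits: "\<exists>t::nat. \<forall>x<u. bit t x = C x"
  by (rule exI[of _ "horner_sum of_bool 2 (map C [0..<u])"]) (simp add: bit_horner_sum_bit_iff)

text \<open>By Baire category a single program \<open>p\<close> computes \<open>B \<circ> g\<close> from \<open>B\<close> on a dense set of \<open>B\<close>
  extending a fixed finite string. If \<open>p\<close> returns different values at \<open>n\<close> with two oracles that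
  extend this string and differ only at \<open>m\<close>, then \<open>g n = m\<close>, so \<open>g n\<close> is found by searching
  for such oracles among the finite sets.\<close>

lemma computable_if_uniformly_reducible:
  assumes "inj g" and reducible: "\<And>B. (B \<circ> g) \<le>\<^sub>T B"
  shows "computable g"
proof -
  define S where "S p B \<longleftrightarrow> (\<forall>n. computes B p [n] (of_bool (B (g n))))" for p B
  have S_D: "computes B p [n] (of_bool (B (g n)))" if "S p B" for p B n
    using that by (simp only: S_def)
  have "\<exists>p. S p B" for B
    using reducible[of B] by (simp add: S_def turing_reducible_def computable_in_def)
  from cantor_Baire[of S, OF this] obtain p C l
    where dense: "\<And>A u. \<forall>x<l. A x = C x \<Longrightarrow> \<exists>B. (\<forall>x<u. B x = A x) \<and> S p B"
    by blast
  obtain c :: nat where c: "\<And>x. x < l \<Longrightarrow> bit c x = C x"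
    using ex_nat_bits by blast
  \<comment> \<open>The oracle extends the fixed string, coded by \<open>c\<close>, and takes the
    digits of \<open>t\<close> elsewhere. For a given \<open>t\<close>, changing \<open>i\<close>
    can alter it only at \<open>m\<close>.\<close>
  define D where
    "D m i t x \<longleftrightarrow> (if x < l then bit c x else if x = m then i = 1 else bit t x)" for m i t x :: nat
  \<comment> \<open>In coded form, the values \<open>1\<close> and \<open>2\<close> below are the
    outputs \<open>0\<close> and \<open>1\<close>.\<close>
  define ev where "ev n m i t w = eval_bounded w (D m i t) p [n]" for n m i t w
  define good where "good t m w n \<longleftrightarrow> l \<le> m \<and> ev n m 0 t w = 1 \<and> ev n m 1 t w = 2" for t m w n

  have g_eq: "g n = m" if "good t m w n" for t m w n
  proof -
    \<comment> \<open>\<open>S p\<close> may fail for \<open>D m i t\<close> itself. Density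
      supplies a \<open>B\<close> satisfying it that agrees with \<open>D m i t\<close> on the use
      and at \<open>g n\<close>, which forces the output to be the oracle's value there.\<close>
    have oracle_value: "D m i t (g n) = b" if b: "computes (D m i t) p [n] (of_bool b)" for i b
    proof -
      obtain u where u: "\<And>B. \<forall>x<u. B x = D m i t x \<Longrightarrow> computes B p [n] (of_bool b)"
        using computes_use[OF b] unfolding eventually_sequentially by blast
      obtain B where "\<forall>x<max u (Suc (g n)). B x = D m i t x" and "S p B"
        using dense[of "D m i t" "max u (Suc (g n))"] c D_def by auto
      then have "computes B p [n] (of_bool b)" and "B (g n) = D m i t (g n)"
        using u[of B] by simp_all
      with computes_unique[OF S_D[OF \<open>S p B\<close>, of n] this(1)] show ?thesis
        by (simp only: of_bool_eq_iff)
    qed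
    have "computes (D m 0 t) p [n] (of_bool False)" and "computes (D m 1 t) p [n] (of_bool True)"
      using that by (auto simp: good_def ev_def numeral_2_eq_2 intro: eval_bounded_sound)
    then have "\<not> D m 0 t (g n)" and "D m 1 t (g n)"
      using oracle_value[of 0 False] oracle_value[of 1 True] by simp_all
    moreover have "D m 0 t x = D m 1 t x" if "x \<noteq> m" for x
      using that by (simp add: D_def)
    ultimately show ?thesis
      by blast
  qed

  have ex_good: "\<exists>w. \<exists>m<w. \<exists>t<w. good t m w n" if "l \<le> g n" for n
  proof -
    let ?m = "g n"
    \<comment> \<open>\<open>A\<close> gives output \<open>0\<close>. Below, \<open>B\<close> copies
      \<open>A\<close> on its use except at \<open>?m\<close> and gives output \<open>1\<close>; the
      digits of \<open>t\<close> are those of \<open>B\<close> far enough for both uses.\<close>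
    obtain A where A: "\<forall>x<Suc ?m. A x = (x < l \<and> C x)" "S p A"
      using dense[of "\<lambda>x. x < l \<and> C x" "Suc ?m"] by auto
    then have "\<not> A ?m"
      using that by simp
    then have A0: "computes A p [n] 0"
      using S_D[OF A(2), of n] by simp
    obtain u where u: "\<And>B. \<forall>x<u. B x = A x \<Longrightarrow> computes B p [n] 0"
      using computes_use[OF A0] unfolding eventually_sequentially by blast
    have "\<forall>x<l. (A(?m := True)) x = C x"
      using A(1) that by simp
    from dense[OF this, of "max u (Suc ?m)"]
    obtain B where B: "\<forall>x<max u (Suc ?m). B x = (A(?m := True)) x" "S p B"
      by (elim exE conjE)
    then have "B ?m"
      by simp
    then have B1: "computes B p [n] 1"
      using S_D[OF B(2), of n] by simp
    obtain v where v: "\<And>B'. \<forall>x<v. B' x = B x \<Longrightarrow> computes B' p [n] 1"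
      using computes_use[OF B1] unfolding eventually_sequentially by blast
    obtain t :: nat where t: "\<forall>x<max u v. bit t x = B x"
      using ex_nat_bits by blast
    have BC: "B x = C x" if "x < l" for x
      using that A(1) B(1) \<open>l \<le> ?m\<close> by simp
    have "computes (D ?m 0 t) p [n] 0"
      using A(1) B(1) \<open>\<not> A ?m\<close> t c \<open>l \<le> ?m\<close> by (intro u) (auto simp: D_def)
    moreover have "computes (D ?m 1 t) p [n] 1"
      using \<open>B ?m\<close> t c BC by (intro v) (auto simp: D_def)
    ultimately have "\<forall>\<^sub>F w in sequentially. ev n ?m 0 t w = Suc 0"
      and "\<forall>\<^sub>F w in sequentially. ev n ?m 1 t w = Suc 1"
      unfolding ev_def by (simp_all only: eval_bounded_complete)
    then have "\<forall>\<^sub>F w in sequentially. ?m < w \<and> t < w \<and> good t ?m w n"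
      using eventually_gt_at_top[of ?m] eventually_gt_at_top[of t]
      by eventually_elim (use that in \<open>simp add: good_def\<close>)
    then show ?thesis
      unfolding eventually_sequentially by blast
  qed

  have D: "recursive (Suc 4) (\<lambda>ys. of_bool (D (tl ys ! 0) (tl ys ! 1) (tl ys ! 2) (hd ys)))"
  proof (rule recursive_cong)
    let ?F = "\<lambda>ys. if \<not> l \<le> ys ! 0 then of_bool (bit c (ys ! 0))
      else if ys ! 0 = ys ! 1 then of_bool (ys ! 2 = 1) else of_bool (bit (ys ! 3) (ys ! 0)) :: nat"
    show "recursive (Suc 4) ?F"
      by (intro recursive_if recursive_not recursive_le recursive_eq recursive_bit
          recursive_const recursive_nth) simp_all
    show "?F ys = of_bool (D (tl ys ! 0) (tl ys ! 1) (tl ys ! 2) (hd ys))" if "length ys = Suc 4" for ys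
      using that by (cases ys) (simp_all add: D_def)
  qed
  have "recursive 5 (\<lambda>ys. ev (ys ! 0) (ys ! 1) (ys ! 2) (ys ! 3) (ys ! 4))"
  proof (rule recursive_cong)
    show "recursive 5 (\<lambda>ys. eval_bounded (drop 1 ys ! 3)
        (D (drop 1 ys ! 0) (drop 1 ys ! 1) (drop 1 ys ! 2)) p (take 1 ys))"
      using recursive_eval_bounded[OF recursive_nth D, of 3 1 p] by simp
    show "eval_bounded (drop 1 ys ! 3)
        (D (drop 1 ys ! 0) (drop 1 ys ! 1) (drop 1 ys ! 2)) p (take 1 ys) =
        ev (ys ! 0) (ys ! 1) (ys ! 2) (ys ! 3) (ys ! 4)" if "length ys = 5" for ys
      using that by (cases ys) (simp_all add: ev_def)
  qed
  then have ev: "recursive 4 (\<lambda>ys. ev (ys ! 3) (ys ! 1) i (ys ! 0) (ys ! 2))" for i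
    using recursive_comp[of "[\<lambda>ys. ys ! 3, \<lambda>ys. ys ! 1, \<lambda>ys. i, \<lambda>ys. ys ! 0, \<lambda>ys. ys ! 2]"
      "\<lambda>ys. ev (ys ! 0) (ys ! 1) (ys ! 2) (ys ! 3) (ys ! 4)" 4]
    by (simp add: recursive_nth recursive_const numeral_eq_Suc)
  \<comment> \<open>The order \<open>t\<close>, \<open>m\<close>, \<open>w\<close>, \<open>n\<close>
    lets each later quantifier or search bind the first argument.\<close>
  have good: "recursive 4 (\<lambda>ys. of_bool (\<not> good (ys ! 0) (ys ! 1) (ys ! 2) (ys ! 3)))"
    unfolding good_def
    by (intro recursive_not recursive_conj recursive_le recursive_eq ev recursive_const recursive_nth)
      simp
  have no_t: "recursive 3 (\<lambda>ys. of_bool (\<not> (\<exists>t<ys ! 1. good t (ys ! 0) (ys ! 1) (ys ! 2))))"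
    using recursive_all_less[of 3 "\<lambda>ys. ys ! 1", OF recursive_nth,
        of "\<lambda>ys. \<not> good (ys ! 0) (ys ! 1) (ys ! 2) (ys ! 3)"] good by simp
  have no_m: "recursive 2 (\<lambda>ys. of_bool (\<not> (\<exists>m<ys ! 0. \<exists>t<ys ! 0. good t m (ys ! 0) (ys ! 1))))"
    using recursive_all_less[of 2 "\<lambda>ys. ys ! 0", OF recursive_nth,
        of "\<lambda>ys. \<not> (\<exists>t<ys ! 1. good t (ys ! 0) (ys ! 1) (ys ! 2))"] no_t by simp

  \<comment> \<open>Where \<open>g n\<close> falls inside the fixed string, the oracle cannot be
    varied there; by injectivity this concerns finitely many \<open>n\<close>.\<close>
  have "finite {n. g n < l}"
    using finite_vimageI[OF finite_lessThan[of l] \<open>inj g\<close>] by (simp add: vimage_def)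
  then obtain N where N: "\<And>n. N \<le> n \<Longrightarrow> l \<le> g n"
    unfolding finite_nat_set_iff_bounded by (auto simp: not_less[symmetric])
  \<comment> \<open>The guard \<open>N \<le> n\<close> makes both searches total: below
    \<open>N\<close> they return \<open>0\<close>.\<close>
  define W where "W n = (LEAST w. N \<le> n \<longrightarrow> (\<exists>m<w. \<exists>t<w. good t m w n))" for n
  define h where "h n = (LEAST m. N \<le> n \<longrightarrow> (\<exists>t<W n. good t m (W n) n))" for n
  have ex_W: "\<exists>w. N \<le> n \<longrightarrow> (\<exists>m<w. \<exists>t<w. good t m w n)" for n
    using ex_good N by blast
  then have "N \<le> n \<longrightarrow> (\<exists>m<W n. \<exists>t<W n. good t m (W n) n)" for n
    unfolding W_def by (rule LeastI_ex)
  then have ex_h: "\<exists>m. N \<le> n \<longrightarrow> (\<exists>t<W n. good t m (W n) n)" for n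
    by blast
  then have h: "N \<le> n \<longrightarrow> (\<exists>t<W n. good t (h n) (W n) n)" for n
    unfolding h_def by (rule LeastI_ex)
  have W_rec: "recursive 1 (\<lambda>xs. W (xs ! 0))"
  proof (rule recursive_cong[OF recursive_Least])
    show "recursive (Suc 1) (\<lambda>ys. of_bool (N \<le> ys ! 1 \<and>
        \<not> (\<exists>m<ys ! 0. \<exists>t<ys ! 0. good t m (ys ! 0) (ys ! 1))))"
      using no_m by (intro recursive_conj recursive_le recursive_const recursive_nth)
        (simp_all add: numeral_2_eq_2)
  qed (use ex_W in \<open>simp_all add: W_def\<close>)
  have "recursive 1 (\<lambda>xs. h (xs ! 0))"
  proof (rule recursive_cong[OF recursive_Least])
    show "recursive (Suc 1) (\<lambda>ys. of_bool (N \<le> ys ! 1 \<and>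
        \<not> (\<exists>t<W (ys ! 1). good t (ys ! 0) (W (ys ! 1)) (ys ! 1))))"
    proof (intro recursive_conj recursive_le recursive_const recursive_nth)
      show "recursive (Suc 1) (\<lambda>ys. of_bool (\<not> (\<exists>t<W (ys ! 1). good t (ys ! 0) (W (ys ! 1)) (ys ! 1))))"
        using recursive_comp[of "[\<lambda>ys. ys ! 0, \<lambda>ys. W (ys ! 1), \<lambda>ys. ys ! 1]"
          "\<lambda>ys. of_bool (\<not> (\<exists>t<ys ! 1. good t (ys ! 0) (ys ! 1) (ys ! 2)))" "Suc 1"]
          no_t recursive_comp1[OF W_rec recursive_nth[of 1 "Suc 1"]]
        by (simp add: recursive_nth numeral_3_eq_3 numeral_2_eq_2)
    qed simp
  qed (use ex_h in \<open>simp_all add: h_def\<close>)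
  moreover have "h n = g n" if "N \<le> n" for n
  proof -
    obtain t where "good t (h n) (W n) n"
      using h[of n] \<open>N \<le> n\<close> by auto
    from g_eq[OF this] show ?thesis ..
  qed
  ultimately show ?thesis
    unfolding computable_iff_recursive by (rule recursive_finite_patch)
qed

section \<open>Recovering the permutation from the conjugated successor\<close>

lemma computable_if_conjugate_Suc_computable:
  assumes "bij \<theta>" and "computable (inv \<theta> \<circ> Suc \<circ> \<theta>)"
  shows "computable (inv \<theta>)" and "computable \<theta>"
proof -
  let ?g = "inv \<theta> \<circ> Suc \<circ> \<theta>"
  have \<theta>_inv: "\<theta> (inv \<theta> k) = k" for k
    using assms(1) by (simp add: bij_is_surj surj_f_inv_f)
  have g: "recursive 1 (\<lambda>ys. ?g (ys ! 0))"
    using assms(2) by (simp only: computable_iff_recursive)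
  have inv: "recursive 1 (\<lambda>xs. inv \<theta> (xs ! 0))"
  proof (rule recursive_cong[OF recursive_rec[OF recursive_nth recursive_const[of 1 "inv \<theta> 0"]]])
    show "recursive (Suc (Suc 1)) (\<lambda>ys. ?g (ys ! 1))"
      by (rule recursive_comp1[OF g recursive_nth]) simp
    have "rec_nat (inv \<theta> 0) (\<lambda>i v. ?g v) k = inv \<theta> k" for k
      by (induction k) (simp_all add: \<theta>_inv)
    then show "rec_nat (inv \<theta> 0) (\<lambda>i v. ?g ((i # v # xs) ! 1)) (xs ! 0) = inv \<theta> (xs ! 0)" for xs
      by simp
  qed simp
  then show "computable (inv \<theta>)"
    by (simp add: computable_iff_recursive)
  \<comment> \<open>By injectivity the only solution is \<open>\<theta> n\<close>, so minimization
    inverts \<open>inv \<theta>\<close>.\<close>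
  have least: "(LEAST k. inv \<theta> k = n) = \<theta> n" for n
    using assms(1) \<theta>_inv by (intro Least_equality) (auto simp: bij_is_inj)
  have "recursive 1 (\<lambda>xs. \<theta> (xs ! 0))"
  proof (rule recursive_cong[OF recursive_Least])
    show "recursive (Suc 1) (\<lambda>ys. of_bool (\<not> inv \<theta> (ys ! 0) = ys ! 1))"
      by (intro recursive_not recursive_eq recursive_comp1[OF inv] recursive_nth) simp_all
    show "\<exists>y. of_bool (\<not> inv \<theta> ((y # xs) ! 0) = (y # xs) ! 1) = (0::nat)" for xs
      using assms(1) by (auto simp: bij_is_inj intro: exI[of _ "\<theta> (xs ! 0)"])
  qed (simp add: least)
  then show "computable \<theta>"
    by (simp add: computable_iff_recursive)
qed

lemma one_one_reducible_comp:
  assumes "computable f" and "inj f"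
  shows "(A \<circ> f) \<le>\<^sub>1 A"
  using assms unfolding one_one_reducible_def by auto

lemma computable_Suc: "computable Suc"
  unfolding computable_iff_recursive by (intro recursive_Suc recursive_nth) simp

section \<open>Degrees\<close>

text \<open>Reflexivity puts \<open>X\<close> and \<open>Y\<close> into their own degrees;
  transitivity removes the choice of representatives.\<close>

lemma degree_le_degree_of:
  assumes "reflp r" and "transp r"
  shows "degree_le r (degree_of r X) (degree_of r Y) \<longleftrightarrow> r X Y"
  using assms unfolding degree_le_def degree_of_def reducibility_equiv_def
  by (auto dest: transpD reflpD)

lemma degree_of_eqI:
  assumes "transp r" and "r X Y" and "r Y X"
  shows "degree_of r X = degree_of r Y"
  using assms unfolding degree_of_def reducibility_equiv_def by (auto dest: transpD)

theorem theorem2p6: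
  fixes r :: "cantor \<Rightarrow> cantor \<Rightarrow> bool"
    and \<theta> :: "nat \<Rightarrow> nat"
    and \<pi> :: "cantor set \<Rightarrow> cantor set"
  assumes "reflp r" and "transp r"
    and "\<And>X Y. X \<le>\<^sub>1 Y \<Longrightarrow> r X Y"
    and "\<And>X Y. r X Y \<Longrightarrow> X \<le>\<^sub>T Y"
    and "bij \<theta>"
    and "induces_automorphism r \<theta> \<pi>"
  shows "\<forall>a\<in>degrees r. \<pi> a = a"
proof -
  let ?g = "inv \<theta> \<circ> Suc \<circ> \<theta>"
  have \<pi>: "\<pi> (degree_of r A) = degree_of r (A \<circ> \<theta>)" for A
    using assms(6) by (simp add: induces_automorphism_def)
  have in_degrees: "degree_of r A \<in> degrees r" for A
    unfolding degree_of_def degrees_def by (simp add: quotientI)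
  \<comment> \<open>Order preservation of \<open>\<pi>\<close>, carried over to
    representatives.\<close>
  have mono: "r (X \<circ> \<theta>) (Y \<circ> \<theta>)" if "r X Y" for X Y
    using assms(6) that in_degrees degree_le_degree_of[OF assms(1,2)]
    unfolding induces_automorphism_def degree_automorphism_def by (metis \<pi>)
  have "(B \<circ> ?g) \<le>\<^sub>T B" for B
  proof -
    \<comment> \<open>Chosen so that \<open>?Y \<circ> \<theta>\<close> is \<open>B\<close> and
      \<open>?Y \<circ> Suc \<circ> \<theta>\<close> is \<open>B \<circ> ?g\<close>.\<close>
    let ?Y = "B \<circ> inv \<theta>"
    have "r ((?Y \<circ> Suc) \<circ> \<theta>) (?Y \<circ> \<theta>)"
      by (intro mono assms(3) one_one_reducible_comp computable_Suc) simp
    then show ?thesis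
      using assms(4,5) by (simp add: comp_assoc bij_is_inj)
  qed
  moreover have "inj ?g"
    using assms(5) by (intro inj_compose) (simp_all add: bij_is_inj bij_imp_bij_inv)
  ultimately have "computable ?g"
    by (intro computable_if_uniformly_reducible)
  note computable_if_conjugate_Suc_computable[OF assms(5) this]
  then have "(A \<circ> \<theta>) \<le>\<^sub>1 A" and "(A \<circ> \<theta> \<circ> inv \<theta>) \<le>\<^sub>1 A \<circ> \<theta>" for A
    using assms(5) by (auto intro!: one_one_reducible_comp simp: bij_is_inj bij_imp_bij_inv)
  moreover have "A \<circ> \<theta> \<circ> inv \<theta> = A" for A :: cantor
    using assms(5) by (simp add: fun_eq_iff bij_is_surj surj_f_inv_f)
  ultimately have "degree_of r (A \<circ> \<theta>) = degree_of r A" for A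
    using assms(2,3) by (metis degree_of_eqI)
  then show ?thesis
    using \<pi> unfolding degrees_def degree_of_def by (auto elim!: quotientE)
qed

end
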